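(* Let $L$ be a finite nonempty set, let $\mu>0$ and $0<\mu_\ell\le\mu$ for $\ell\in L$, and let $\sigma_{i\ell}\ge 0$ ($i=1,\ldots,n$, $\ell\in L$) satisfy $\sum_{\ell\in L}\sigma_{i\ell}=1$ for every $i\in\{1,\ldots,n\}$. Consider the generalized nested logit model, i.e. the generalized extreme value model with generating function $$G(x)=\sum_{\ell\in L}\left(\sum_{i=1}^{n}\left(\sigma_{i\ell}\,x^{(i)}\right)^{1/\mu_\ell}\right)^{\mu_\ell/\mu},\qquad x\in\mathbb{R}^n_+,$$ and let $E$ be its surplus function. Then the convex conjugate $E^*$ is $\beta$-strongly convex with respect to the norm $\|\cdot\|_1$, where $$\beta=\frac{1}{\dfrac{2}{\min_{\ell\in L}\mu_\ell}-\dfrac{1}{\mu}}.$$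
   Context: Here $\mathbb{R}^n_+$ is the set of vectors with nonnegative components. The generalized extreme value model with generating function $G$ is the additive random utility model in which the random vector $\epsilon=(\epsilon^{(1)},\ldots,\epsilon^{(n)})^T$ has joint probability density function $$f_\epsilon(y^{(1)},\ldots,y^{(n)})=\frac{\partial^n \exp\left(-G\left(e^{-y^{(1)}},\ldots,e^{-y^{(n)}}\right)\right)}{\partial y^{(1)}\cdots\partial y^{(n)}}.$$ The set $L$ is the set of nests, $\sigma_{i\ell}$ the share with which alternative $i$ is attached to nest $\ell$, and $\mu_\ell$ the nest parameters. The surplus function is $E(u)=\mathbb{E}_\epsilon\left(\max_{1\le i\le n}\left(u^{(i)}+\epsilon^{(i)}\right)\right)$, $u\in\mathbb{R}^n$; it is well known that for generalized extreme value models with $G$ homogeneous of degree $1/\mu$ one has $E(u)=\mu\ln G\left(e^{u^{(1)}},\ldots,e^{u^{(n)}}\right)+\mu\gamma$ with $\gamma$ Euler's constant. Standing assumption: $\epsilon$ has finite mean and its distribution is absolutely continuous and fully supported on $\mathbb{R}^n$. The convex conjugate is $E^*(p)=\sup_{u\in\mathbb{R}^n}\left(\langle p,u\rangle-E(u)\right)$; it is finite exactly on the simplex $\Delta=\{p\in\mathbb{R}^n\mid\sum_{i=1}^n p^{(i)}=1,\ p^{(i)}\ge0\}$. With $\|x\|_1=\sum_i|x^{(i)}|$, $E^*:\Delta\to\mathbb{R}$ is $\beta$-strongly convex with respect to $\|\cdot\|_1$ ($\beta>0$) if for all $p,q\in\Delta$ and $\alpha\in[0,1]$: $E^*(\alpha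 p+(1-\alpha)q)\le\alpha E^*(p)+(1-\alpha)E^*(q)-\frac{\beta}{2}\alpha(1-\alpha)\|p-q\|_1^2$. *)

theory Defs
  imports "HOL-Probability.Probability"
begin

text \<open>Alternatives are indexed by a finite type, so the number of alternatives is its cardinality
  and vectors of utilities and choice probabilities live in \<open>real ^ 'n\<close>.\<close>

definition partial_deriv :: "'n \<Rightarrow> (real ^ 'n \<Rightarrow> real) \<Rightarrow> real ^ 'n \<Rightarrow> real" where
  "partial_deriv i f y = deriv (\<lambda>t. f (\<chi> j. if j = i then t else y $ j)) (y $ i)"

primrec mixed_partial :: "'n list \<Rightarrow> (real ^ 'n \<Rightarrow> real) \<Rightarrow> real ^ 'n \<Rightarrow> real" where
  "mixed_partial [] f = f"
| "mixed_partial (i # is) f = partial_deriv i (mixed_partial is f)"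

text \<open>The list \<open>ks\<close> gives the order in which the differentiations are written.\<close>

definition gev_density :: "'n list \<Rightarrow> (real ^ 'n \<Rightarrow> real) \<Rightarrow> real ^ 'n \<Rightarrow> real" where
  "gev_density ks G = mixed_partial ks (\<lambda>y. exp (- G (\<chi> i. exp (- y $ i))))"

definition additive_random_utility :: "'a measure \<Rightarrow> ('a \<Rightarrow> real ^ 'n) \<Rightarrow> bool" where
  "additive_random_utility M \<epsilon> \<longleftrightarrow>
     prob_space M \<and> integrable M \<epsilon> \<and>
     absolutely_continuous lborel (distr M lborel \<epsilon>) \<and>
     (\<forall>U. open U \<and> U \<noteq> {} \<longrightarrow> measure M (\<epsilon> -` U \<inter> space M) > 0)"

text \<open>Nonnegativity of the density is stated explicitly because \<open>ennreal\<close> truncates negative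
  values to zero.\<close>

definition generalized_extreme_value ::
  "'n list \<Rightarrow> (real ^ 'n \<Rightarrow> real) \<Rightarrow> 'a measure \<Rightarrow> ('a \<Rightarrow> real ^ 'n) \<Rightarrow> bool" where
  "generalized_extreme_value ks G M \<epsilon> \<longleftrightarrow>
     additive_random_utility M \<epsilon> \<and>
     distinct ks \<and> set ks = UNIV \<and>
     (\<forall>y. 0 \<le> gev_density ks G y) \<and>
     distributed M lborel \<epsilon> (\<lambda>y. ennreal (gev_density ks G y))"

definition surplus :: "'a measure \<Rightarrow> ('a \<Rightarrow> real ^ 'n) \<Rightarrow> real ^ 'n \<Rightarrow> real" where
  "surplus M \<epsilon> u = (\<integral>\<omega>. Max (range (\<lambda>i. u $ i + \<epsilon> \<omega> $ i)) \<partial>M)"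

text \<open>All bases below are nonnegative and all exponents positive, so the convention
  \<open>0 powr a = 0\<close> agrees with the usual power.\<close>

definition gnl_generator ::
  "'l set \<Rightarrow> real \<Rightarrow> ('l \<Rightarrow> real) \<Rightarrow> ('n \<Rightarrow> 'l \<Rightarrow> real) \<Rightarrow> real ^ 'n \<Rightarrow> real" where
  "gnl_generator L \<mu> \<mu>n \<sigma> x =
     (\<Sum>l\<in>L. (\<Sum>i\<in>UNIV. (\<sigma> i l * x $ i) powr (1 / \<mu>n l)) powr (\<mu>n l / \<mu>))"

definition convex_conjugate :: "(real ^ 'n \<Rightarrow> real) \<Rightarrow> real ^ 'n \<Rightarrow> ereal" where
  "convex_conjugate E p = (SUP u. ereal (p \<bullet> u - E u))"

definition prob_simplex :: "(real ^ 'n) set" where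
  "prob_simplex = {p. (\<Sum>i\<in>UNIV. p $ i) = 1 \<and> (\<forall>i. 0 \<le> p $ i)}"

definition l1_norm :: "real ^ 'n \<Rightarrow> real" where
  "l1_norm x = (\<Sum>i\<in>UNIV. \<bar>x $ i\<bar>)"

text \<open>The finiteness clause says that the extended-real function restricts to a real-valued
  function on the simplex.\<close>

definition strongly_convex_l1 :: "real \<Rightarrow> (real ^ 'n \<Rightarrow> ereal) \<Rightarrow> bool" where
  "strongly_convex_l1 \<beta> f \<longleftrightarrow>
     0 < \<beta> \<and>
     (\<forall>p\<in>prob_simplex. \<bar>f p\<bar> \<noteq> \<infinity>) \<and>
     (\<forall>p\<in>prob_simplex. \<forall>q\<in>prob_simplex. \<forall>\<alpha>\<in>{0..1}.
        f (\<alpha> *\<^sub>R p + (1 - \<alpha>) *\<^sub>R q)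
          \<le> ereal \<alpha> * f p + ereal (1 - \<alpha>) * f q
             - ereal (\<beta> / 2 * \<alpha> * (1 - \<alpha>) * (l1_norm (p - q))\<^sup>2))"

end

theory Submission
  imports Defs "HOL-Real_Asymp.Real_Asymp"
begin

text \<open>Write \<open>H u = G (exp u)\<close>, the exponential being taken componentwise.  The argument has three
  parts.

  The surplus equals \<open>\<mu> * ln (H u)\<close> up to a constant (\<open>surplus_eq_ln\<close>).  Integrating the density,
  which is a mixed partial derivative, over boxes by Fubini and the fundamental theorem of calculus and
  letting the lower corner tend to minus infinity gives the joint distribution function
  \<open>exp (- G (exp (- y)))\<close> (\<open>cdf_of_mixed_partial_density\<close>).  Since \<open>G\<close> is homogeneous of degree
  \<open>1 / \<mu>\<close>, a change of \<open>u\<close> merely translates the law of the maximal utility.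

  The surplus is \<open>1 / m\<close>-smooth in the maximum norm, where \<open>m\<close> is the least nest parameter.  Along a
  line with direction \<open>s\<close> and \<open>\<bar>s $ i\<bar> \<le> S\<close>, a nonnegative combination \<open>f\<close> of the exponentials of
  \<open>t * s $ i / \<mu>n l\<close> satisfies \<open>f'' \<le> C f\<close> with \<open>C = (S / \<mu>n l)\<^sup>2\<close>.  Raising a positive \<open>f\<close> to a power
  \<open>\<theta>\<close> between \<open>0\<close> and \<open>1\<close> replaces \<open>C\<close> by \<open>\<theta> * C\<close>, and the inequality survives summation over nests;
  hence \<open>H\<close> satisfies it along the line with \<open>C = S\<^sup>2 / (\<mu> * m)\<close> (\<open>log_growth_gnl\<close>), and \<open>\<mu> * ln H\<close> has second derivative at most \<open>S\<^sup>2 / m\<close>.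
  As \<open>m \<le> \<mu>\<close>, the constant \<open>1 / m\<close> is at most \<open>2 / m - 1 / \<mu>\<close>.

  Smoothness of a function in the maximum norm gives strong convexity of its conjugate in the dual
  norm \<open>l1_norm\<close> (\<open>strongly_convex_conjugate\<close>), by testing the suprema that define the conjugate at
  two suitable points.\<close>

section \<open>A class of functions closed under partial differentiation\<close>

text \<open>The vector \<open>y\<close> with its \<open>i\<close>-th coordinate replaced by \<open>t\<close>.\<close>

definition vec_upd :: "real ^ 'n \<Rightarrow> 'n \<Rightarrow> real \<Rightarrow> real ^ 'n" where
  "vec_upd y i t = (\<chi> j. if j = i then t else y $ j)"

lemma vec_upd_nth: "vec_upd y i t $ j = (if j = i then t else y $ j)"
  by (simp add: vec_upd_def)

lemma vec_upd_same [simp]: "vec_upd y i (y $ i) = y"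
  by (simp add: vec_eq_iff vec_upd_nth)

lemma vec_upd_upd [simp]: "vec_upd (vec_upd y i s) i t = vec_upd y i t"
  by (simp add: vec_eq_iff vec_upd_nth)

lemma partial_deriv_eqI:
  assumes "((\<lambda>t. f (vec_upd y i t)) has_real_derivative d) (at (y $ i))"
  shows "partial_deriv i f y = d"
  using DERIV_imp_deriv[OF assms] by (simp add: partial_deriv_def vec_upd_def)

text \<open>A syntactic class of smooth functions.  Every member is continuous, and its partial derivatives
  are again members; so the iterated partial derivatives, which are defined by the total operator
  \<open>deriv\<close>, are genuine derivatives.\<close>

inductive smooth_expr :: "(real ^ 'n \<Rightarrow> real) \<Rightarrow> bool" where
  const: "smooth_expr (\<lambda>_. c)"
| coord: "smooth_expr (\<lambda>y. y $ i)"
| add: "smooth_expr f \<Longrightarrow> smooth_expr g \<Longrightarrow> smooth_expr (\<lambda>y. f y + g y)"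
| mult: "smooth_expr f \<Longrightarrow> smooth_expr g \<Longrightarrow> smooth_expr (\<lambda>y. f y * g y)"
| exp: "smooth_expr f \<Longrightarrow> smooth_expr (\<lambda>y. exp (f y))"
| powr: "smooth_expr f \<Longrightarrow> (\<And>y. 0 < f y) \<Longrightarrow> smooth_expr (\<lambda>y. f y powr r)"

lemma smooth_expr_uminus: "smooth_expr f \<Longrightarrow> smooth_expr (\<lambda>y. - f y)"
  using smooth_expr.mult[OF smooth_expr.const[of "-1"]] by simp

lemma smooth_expr_sum:
  assumes "\<And>l. l \<in> A \<Longrightarrow> smooth_expr (f l)"
  shows "smooth_expr (\<lambda>y. \<Sum>l\<in>A. f l y)"
  using assms
  by (induction A rule: infinite_finite_induct) (auto intro: smooth_expr.const smooth_expr.add)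

lemma smooth_expr_continuous: "smooth_expr f \<Longrightarrow> continuous_on S f"
proof (induction rule: smooth_expr.induct)
  case (powr f r)
  then show ?case by (intro continuous_intros) (auto simp: less_imp_neq[symmetric])
qed (intro continuous_intros | assumption)+

lemma smooth_expr_partial_derivative:
  assumes "smooth_expr f"
  shows "\<exists>g. smooth_expr g \<and>
    (\<forall>y. ((\<lambda>t. f (vec_upd y i t)) has_real_derivative g y) (at (y $ i)))"
  using assms
proof (induction rule: smooth_expr.induct)
  case (const c)
  show ?case by (intro exI[of _ "\<lambda>_. 0"]) (auto intro: smooth_expr.const)
next
  case (coord j)
  show ?case
    by (intro exI[of _ "\<lambda>_. if j = i then 1 else 0"])
      (auto intro: smooth_expr.const simp: vec_upd_nth)
next
  case (add f g)
  then obtain f' g' where "smooth_expr f'" "smooth_expr g'"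
    "\<And>y. ((\<lambda>t. f (vec_upd y i t)) has_real_derivative f' y) (at (y $ i))"
    "\<And>y. ((\<lambda>t. g (vec_upd y i t)) has_real_derivative g' y) (at (y $ i))"
    by blast
  then show ?case
    by (intro exI[of _ "\<lambda>y. f' y + g' y"]) (auto intro: smooth_expr.add DERIV_add)
next
  case (mult f g)
  then obtain f' g' where *: "smooth_expr f'" "smooth_expr g'"
    "\<And>y. ((\<lambda>t. f (vec_upd y i t)) has_real_derivative f' y) (at (y $ i))"
    "\<And>y. ((\<lambda>t. g (vec_upd y i t)) has_real_derivative g' y) (at (y $ i))"
    by blast
  have "((\<lambda>t. f (vec_upd y i t) * g (vec_upd y i t)) has_real_derivative
      f' y * g y + g' y * f y) (at (y $ i))" for y
    using DERIV_mult[OF *(3)[of y] *(4)[of y]] by simp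
  with * mult show ?case
    by (intro exI[of _ "\<lambda>y. f' y * g y + g' y * f y"])
      (auto intro: smooth_expr.add smooth_expr.mult)
next
  case (exp f)
  then obtain f' where *: "smooth_expr f'"
    "\<And>y. ((\<lambda>t. f (vec_upd y i t)) has_real_derivative f' y) (at (y $ i))"
    by blast
  have "((\<lambda>t. exp (f (vec_upd y i t))) has_real_derivative exp (f y) * f' y) (at (y $ i))" for y
    using DERIV_fun_exp[OF *(2)[of y]] by simp
  with * exp show ?case
    by (intro exI[of _ "\<lambda>y. exp (f y) * f' y"])
      (auto intro: smooth_expr.exp smooth_expr.mult)
next
  case (powr f r)
  then obtain f' where *: "smooth_expr f'"
    "\<And>y. ((\<lambda>t. f (vec_upd y i t)) has_real_derivative f' y) (at (y $ i))"
    by blast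
  have "((\<lambda>t. f (vec_upd y i t) powr r) has_real_derivative
      r * f y powr (r - 1) * f' y) (at (y $ i))" for y
    using DERIV_fun_powr[OF *(2)[of y], of r] powr by simp
  moreover have "smooth_expr (\<lambda>y. r * f y powr (r - 1) * f' y)"
    by (intro smooth_expr.mult smooth_expr.const smooth_expr.powr powr *)
  ultimately show ?case
    by blast
qed

lemma smooth_expr_partial_deriv:
  assumes "smooth_expr f"
  shows "smooth_expr (partial_deriv i f)"
    and "((\<lambda>t. f (vec_upd y i t)) has_real_derivative partial_deriv i f y) (at (y $ i))"
proof -
  obtain g where g: "smooth_expr g"
    "\<And>y. ((\<lambda>t. f (vec_upd y i t)) has_real_derivative g y) (at (y $ i))"
    using smooth_expr_partial_derivative[OF assms] by blast
  have "partial_deriv i f = g"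
    by (intro ext partial_deriv_eqI g)
  with g show "smooth_expr (partial_deriv i f)"
    "((\<lambda>t. f (vec_upd y i t)) has_real_derivative partial_deriv i f y) (at (y $ i))"
    by auto
qed

lemma smooth_expr_mixed_partial: "smooth_expr f \<Longrightarrow> smooth_expr (mixed_partial ks f)"
  by (induction ks) (auto intro: smooth_expr_partial_deriv)

section \<open>Integrating a mixed partial derivative over a box\<close>

text \<open>The iterated difference of \<open>f\<close> over the box with corners \<open>a\<close> and \<open>b\<close> in the coordinates
  of the list, with the other coordinates taken from \<open>y\<close>: the signed sum of \<open>f\<close> over the vertices
  of the box.\<close>

primrec box_diff ::
  "'n list \<Rightarrow> real ^ 'n \<Rightarrow> real ^ 'n \<Rightarrow> (real ^ 'n \<Rightarrow> real) \<Rightarrow> real ^ 'n \<Rightarrow> real" where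
  "box_diff [] a b f y = f y"
| "box_diff (i # is) a b f y =
     box_diff is a b f (vec_upd y i (b $ i)) - box_diff is a b f (vec_upd y i (a $ i))"

text \<open>The vector \<open>y\<close> with its coordinates in \<open>I\<close> taken from the function \<open>x\<close>.  Iterated integrals
  run over \<open>x\<close> in the product measure indexed by \<open>I\<close>, the coordinates outside \<open>I\<close> being
  parameters.\<close>

definition override_vec :: "'n set \<Rightarrow> real ^ 'n \<Rightarrow> ('n \<Rightarrow> real) \<Rightarrow> real ^ 'n" where
  "override_vec I y x = (\<chi> j. if j \<in> I then x j else y $ j)"

lemma override_vec_nth: "override_vec I y x $ j = (if j \<in> I then x j else y $ j)"
  by (simp add: override_vec_def)

lemma continuous_on_vec_upd: "continuous_on S (vec_upd y i)"
  unfolding continuous_on_def vec_upd_def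
  by (intro ballI vec_tendstoI) (auto intro: tendsto_ident_at)

lemma measurable_override_vec:
  "override_vec I y \<in> borel_measurable (Pi\<^sub>M I (\<lambda>_. lborel))"
proof -
  have "(\<lambda>x. override_vec I y x \<bullet> b) \<in> borel_measurable (Pi\<^sub>M I (\<lambda>_. lborel))"
    if "b \<in> Basis" for b
  proof -
    from that obtain j where b: "b = axis j 1"
      by (auto simp: Basis_vec_def)
    show ?thesis
      by (cases "j \<in> I") (simp_all add: b inner_axis override_vec_nth)
  qed
  then show ?thesis
    by (subst borel_measurable_euclidean_space) blast
qed

lemma override_vec_insert:
  assumes "i \<notin> I"
  shows "override_vec (insert i I) y (x(i := t)) = vec_upd (override_vec I y x) i t"
    and "vec_upd (override_vec I y x) i t = override_vec I (vec_upd y i t) x"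
  using assms by (auto simp: vec_eq_iff override_vec_nth vec_upd_nth)

interpretation product_lborel: product_sigma_finite "\<lambda>_. lborel"
  by standard

text \<open>The indicator of the box in the coordinates \<open>I\<close>, as a product, which splits off one
  coordinate at a time.\<close>

abbreviation box_indicator ::
  "'n set \<Rightarrow> real ^ 'n \<Rightarrow> real ^ 'n \<Rightarrow> ('n \<Rightarrow> real) \<Rightarrow> real" where
  "box_indicator I a b x \<equiv> (\<Prod>j\<in>I. indicator {a $ j..b $ j} (x j))"

text \<open>A continuous function is bounded on the compact box.\<close>

lemma integrable_box_indicator_mult:
  fixes f :: "real ^ 'n \<Rightarrow> real"
  assumes "continuous_on UNIV f"
  shows "integrable (Pi\<^sub>M I (\<lambda>_. lborel)) (\<lambda>x. box_indicator I a b x * f (override_vec I y x))"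
proof -
  let ?K = "cbox (override_vec I y (($) a)) (override_vec I y (($) b))"
  have "bounded (f ` ?K)"
    by (intro compact_imp_bounded compact_continuous_image continuous_on_subset[OF assms]) auto
  then obtain C where C: "\<And>z. z \<in> ?K \<Longrightarrow> \<bar>f z\<bar> \<le> C"
    by (force simp: bounded_iff)
  have bound: "\<bar>box_indicator I a b x * f (override_vec I y x)\<bar> \<le> \<bar>box_indicator I a b x * C\<bar>" for x
  proof (cases "\<forall>j\<in>I. x j \<in> {a $ j..b $ j}")
    case True
    then have "override_vec I y x \<in> ?K"
      by (auto simp: mem_box_cart override_vec_nth)
    with C[of "override_vec I y x"] show ?thesis
      by (simp add: abs_mult mult_left_mono)
  next
    case False
    then have "box_indicator I a b x = 0"
      by (auto simp: indicator_def)
    then show ?thesis by (simp only: mult_zero_left abs_zero)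
  qed
  have "integrable (Pi\<^sub>M I (\<lambda>_. lborel)) (box_indicator I a b)"
    by (intro product_lborel.product_integrable_prod) (auto simp: emeasure_lborel_Icc_eq)
  then have "integrable (Pi\<^sub>M I (\<lambda>_. lborel)) (\<lambda>x. box_indicator I a b x * C)"
    by simp
  moreover have "(\<lambda>x. f (override_vec I y x)) \<in> borel_measurable (Pi\<^sub>M I (\<lambda>_. lborel))"
    using measurable_compose[OF measurable_override_vec borel_measurable_continuous_onI[OF assms]] .
  ultimately show ?thesis
    using bound
    by (elim Bochner_Integration.integrable_bound) auto
qed

text \<open>Fubini and the fundamental theorem of calculus, one coordinate at a time.  The outermost
  derivative, that of the head of the list, is integrated first.\<close>

lemma integral_mixed_partial:
  fixes f :: "real ^ 'n \<Rightarrow> real"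
  assumes "smooth_expr f" and "distinct ks" and "\<And>i. a $ i \<le> b $ i"
  shows "(\<integral>x. box_indicator (set ks) a b x * mixed_partial ks f (override_vec (set ks) y x)
           \<partial>Pi\<^sub>M (set ks) (\<lambda>_. lborel)) = box_diff ks a b f y"
  using assms(2)
proof (induction ks arbitrary: y)
  case Nil
  have "override_vec {} y x = y" for x
    by (simp add: vec_eq_iff override_vec_nth)
  then show ?case
    by (simp add: PiM_empty lebesgue_integral_count_space_finite)
next
  case (Cons i ks)
  let ?I = "set ks" and ?h = "mixed_partial ks f"
  let ?P = "Pi\<^sub>M ?I (\<lambda>_. lborel :: real measure)"
  let ?g = "\<lambda>x. box_indicator (insert i ?I) a b x *
      partial_deriv i ?h (override_vec (insert i ?I) y x)"
  have i: "i \<notin> ?I" "distinct ks"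
    using Cons.prems by auto
  have h: "smooth_expr ?h" "smooth_expr (partial_deriv i ?h)"
    using assms(1) by (auto intro: smooth_expr_mixed_partial smooth_expr_partial_deriv)
  note cont = h[THEN smooth_expr_continuous[where S = UNIV]]
  have inner: "(\<integral>t. ?g (x(i := t)) \<partial>lborel) =
      box_indicator ?I a b x * ?h (override_vec ?I (vec_upd y i (b $ i)) x) -
      box_indicator ?I a b x * ?h (override_vec ?I (vec_upd y i (a $ i)) x)" for x
  proof -
    let ?z = "override_vec ?I y x"
    have *: "(\<Prod>j\<in>?I. indicator {a $ j..b $ j} ((x(i := t)) j)) = (box_indicator ?I a b x :: real)" for t
      using i by (intro prod.cong) auto
    have "?g (x(i := t)) =
        box_indicator ?I a b x *
          (indicator {a $ i..b $ i} t *\<^sub>R partial_deriv i ?h (vec_upd ?z i t))" for t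
      using i by (simp add: * override_vec_insert(1) del: fun_upd_apply) simp
    then have "(\<integral>t. ?g (x(i := t)) \<partial>lborel) = box_indicator ?I a b x *
        (\<integral>t. indicator {a $ i..b $ i} t *\<^sub>R partial_deriv i ?h (vec_upd ?z i t) \<partial>lborel)"
      by simp
    also have "(\<integral>t. indicator {a $ i..b $ i} t *\<^sub>R partial_deriv i ?h (vec_upd ?z i t) \<partial>lborel) =
        ?h (vec_upd ?z i (b $ i)) - ?h (vec_upd ?z i (a $ i))"
    proof (rule integral_FTC_Icc)
      show "((\<lambda>t. ?h (vec_upd ?z i t)) has_vector_derivative partial_deriv i ?h (vec_upd ?z i t))
          (at t within {a $ i..b $ i})" for t
        using smooth_expr_partial_deriv(2)[OF h(1), of "vec_upd ?z i t" i]
        by (simp add: vec_upd_nth has_real_derivative_iff_has_vector_derivative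
            has_vector_derivative_at_within)
      show "continuous_on {a $ i..b $ i} (\<lambda>t. partial_deriv i ?h (vec_upd ?z i t))"
        by (rule continuous_on_compose2[OF cont(2) continuous_on_vec_upd]) simp
    qed (use assms(3) in auto)
    finally show ?thesis
      by (simp only: override_vec_insert(2)[OF i(1)] right_diff_distrib)
  qed
  have "(\<integral>x. ?g x \<partial>Pi\<^sub>M (insert i ?I) (\<lambda>_. lborel)) = (\<integral>x. (\<integral>t. ?g (x(i := t)) \<partial>lborel) \<partial>?P)"
    using i by (intro product_lborel.product_integral_insert integrable_box_indicator_mult cont) auto
  also have "\<dots> = box_diff ks a b f (vec_upd y i (b $ i)) - box_diff ks a b f (vec_upd y i (a $ i))"
    unfolding inner
    by (subst Bochner_Integration.integral_diff)
      (simp_all add: integrable_box_indicator_mult cont Cons.IH i)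
  finally show ?case by simp
qed

lemma lborel_vec_eq_distr:
  "(lborel :: (real ^ 'n) measure) =
     distr (Pi\<^sub>M UNIV (\<lambda>_::'n. lborel)) borel (override_vec UNIV 0)"
proof (rule lborel_eqI)
  fix l u :: "real ^ 'n"
  assume *: "\<And>b. b \<in> Basis \<Longrightarrow> l \<bullet> b \<le> u \<bullet> b"
  have le: "l $ i \<le> u $ i" for i
    using *[of "axis i 1"] by (simp add: axis_in_Basis_iff inner_axis)
  have pre: "override_vec UNIV 0 -` box l u \<inter> space (Pi\<^sub>M UNIV (\<lambda>_::'n. lborel)) =
      Pi\<^sub>E UNIV (\<lambda>i. {l $ i <..< u $ i})"
    by (auto simp: space_PiM mem_box_cart override_vec_nth PiE_def Pi_iff)
  have "emeasure (distr (Pi\<^sub>M UNIV (\<lambda>_::'n. lborel)) borel (override_vec UNIV 0)) (box l u) =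
      (\<Prod>i\<in>UNIV. emeasure lborel {l $ i <..< u $ i})"
    by (subst emeasure_distr)
      (auto simp: measurable_override_vec pre intro!: product_lborel.emeasure_PiM)
  also have "\<dots> = ennreal (\<Prod>i\<in>UNIV. u $ i - l $ i)"
    by (simp add: le prod_ennreal)
  also have "(\<Prod>i\<in>UNIV. u $ i - l $ i) = (\<Prod>b\<in>Basis. (u - l) \<bullet> b)"
    unfolding Basis_vec_def
    by (subst prod.reindex_bij_betw[symmetric, of "\<lambda>i. axis i 1" UNIV])
      (auto simp: bij_betw_def inj_on_def axis_eq_axis inner_axis)
  finally show "emeasure (distr (Pi\<^sub>M UNIV (\<lambda>_::'n. lborel)) borel (override_vec UNIV 0)) (box l u) =
      ennreal (\<Prod>b\<in>Basis. (u - l) \<bullet> b)" .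
qed simp

lemma integral_mixed_partial_cbox:
  fixes f :: "real ^ 'n \<Rightarrow> real"
  assumes "smooth_expr f" and "distinct ks" and "set ks = UNIV" and "\<And>i. a $ i \<le> b $ i"
  shows "integrable lborel (\<lambda>z. indicator (cbox a b) z * mixed_partial ks f z)"
    and "(\<integral>z. indicator (cbox a b) z * mixed_partial ks f z \<partial>lborel) = box_diff ks a b f 0"
proof -
  have [measurable]: "mixed_partial ks f \<in> borel_measurable borel"
    using assms(1)
    by (intro borel_measurable_continuous_onI smooth_expr_continuous smooth_expr_mixed_partial)
  have ind: "indicator (cbox a b) (override_vec UNIV 0 x) = (box_indicator UNIV a b x :: real)" for x
    by (auto simp: indicator_def mem_box_cart override_vec_nth prod.If_cases)
  show "integrable lborel (\<lambda>z. indicator (cbox a b) z * mixed_partial ks f z)"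
    using integrable_box_indicator_mult[of "mixed_partial ks f" UNIV a b 0] assms(1)
    unfolding lborel_vec_eq_distr
    by (subst integrable_distr_eq)
      (auto simp: measurable_override_vec ind smooth_expr_continuous smooth_expr_mixed_partial)
  show "(\<integral>z. indicator (cbox a b) z * mixed_partial ks f z \<partial>lborel) = box_diff ks a b f 0"
    using integral_mixed_partial[OF assms(1,2,4), of 0] assms(3)
    unfolding lborel_vec_eq_distr
    by (subst integral_distr) (auto simp: measurable_override_vec ind)
qed

section \<open>The distribution function of a density given by a mixed partial derivative\<close>

lemma abs_box_diff_le:
  assumes "i \<notin> set ks" and "\<And>z. z $ i = y $ i \<Longrightarrow> \<bar>f z\<bar> \<le> B"
  shows "\<bar>box_diff ks a b f y\<bar> \<le> 2 ^ length ks * B"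
  using assms
proof (induction ks arbitrary: y)
  case (Cons j ks)
  have "\<bar>box_diff ks a b f (vec_upd y j t)\<bar> \<le> 2 ^ length ks * B" for t
    using Cons.prems by (intro Cons.IH) (auto simp: vec_upd_nth)
  from this[of "b $ j"] this[of "a $ j"] show ?case
    by simp
qed auto

text \<open>Send the lower corner of the box to minus infinity: each vertex other than the upper corner has
  a coordinate tending to minus infinity, so \<open>f\<close> vanishes there in the limit.\<close>

lemma box_diff_tendsto:
  fixes f :: "real ^ 'n \<Rightarrow> real"
  assumes "distinct ks"
    and bound: "\<And>i z. \<bar>f z\<bar> \<le> g i (z $ i)"
    and lim: "\<And>i. (g i \<longlongrightarrow> 0) at_bot"
  shows "(\<lambda>k. box_diff ks (\<chi> i. b $ i - real k) b f y) \<longlonglongrightarrow>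
    f (override_vec (set ks) y (($) b))"
  using assms(1)
proof (induction ks arbitrary: y)
  case Nil
  then show ?case by (simp add: override_vec_def vec_eq_iff)
next
  case (Cons i ks)
  let ?a = "\<lambda>k. \<chi> i. b $ i - real k"
  have le: "\<bar>box_diff ks (?a k) b f (vec_upd y i (b $ i - real k))\<bar> \<le>
      2 ^ length ks * g i (b $ i - real k)" for k
  proof (rule abs_box_diff_le)
    show "i \<notin> set ks"
      using Cons.prems by simp
    show "\<bar>f z\<bar> \<le> g i (b $ i - real k)" if "z $ i = vec_upd y i (b $ i - real k) $ i" for z
      using bound[of z i] that by (simp add: vec_upd_nth)
  qed
  have "filterlim (\<lambda>k. b $ i - real k) at_bot sequentially"
    by real_asymp
  then have "(\<lambda>k. 2 ^ length ks * g i (b $ i - real k)) \<longlonglongrightarrow> 0"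
    by (intro tendsto_mult_right_zero filterlim_compose[OF lim])
  then have "(\<lambda>k. box_diff ks (?a k) b f (vec_upd y i (b $ i - real k))) \<longlonglongrightarrow> 0"
    by (rule Lim_null_comparison[rotated]) (use le in auto)
  moreover have "override_vec (set ks) (vec_upd y i (b $ i)) (($) b) =
      override_vec (set (i # ks)) y (($) b)"
    using Cons.prems by (auto simp: vec_eq_iff override_vec_nth vec_upd_nth)
  moreover have "(\<lambda>k. box_diff ks (?a k) b f (vec_upd y i (b $ i))) \<longlonglongrightarrow>
      f (override_vec (set ks) (vec_upd y i (b $ i)) (($) b))"
    using Cons by auto
  ultimately have "(\<lambda>k. box_diff ks (?a k) b f (vec_upd y i (b $ i)) -
      box_diff ks (?a k) b f (vec_upd y i (b $ i - real k))) \<longlonglongrightarrow>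
      f (override_vec (set (i # ks)) y (($) b)) - 0"
    by (intro tendsto_diff) simp_all
  then show ?case by simp
qed

lemma cdf_of_mixed_partial_density:
  fixes f :: "real ^ 'n \<Rightarrow> real"
  assumes "prob_space M"
    and f: "smooth_expr f" and ks: "distinct ks" "set ks = UNIV"
    and nonneg: "\<And>y. 0 \<le> mixed_partial ks f y"
    and dens: "distributed M lborel \<epsilon> (\<lambda>y. ennreal (mixed_partial ks f y))"
    and bound: "\<And>i z. \<bar>f z\<bar> \<le> g i (z $ i)"
    and lim: "\<And>i. (g i \<longlongrightarrow> 0) at_bot"
  shows "measure M {\<omega> \<in> space M. \<forall>i. \<epsilon> \<omega> $ i \<le> b $ i} = f b"
proof -
  interpret prob_space M by fact
  let ?a = "\<lambda>k. \<chi> i. b $ i - real k"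
  define A where "A k = \<epsilon> -` cbox (?a k) b \<inter> space M" for k
  have [measurable]: "\<epsilon> \<in> borel_measurable M"
    using distributed_measurable[OF dens] by simp
  have "measure M (A k) = box_diff ks (?a k) b f 0" for k
  proof -
    have "emeasure M (A k) = (\<integral>\<^sup>+z. ennreal (indicator (cbox (?a k) b) z * mixed_partial ks f z) \<partial>lborel)"
      unfolding A_def
      by (subst distributed_emeasure[OF dens])
        (auto intro!: nn_integral_cong simp: indicator_def)
    also have "\<dots> = ennreal (\<integral>z. indicator (cbox (?a k) b) z * mixed_partial ks f z \<partial>lborel)"
      by (intro nn_integral_eq_integral integral_mixed_partial_cbox f ks) (auto simp: nonneg)
    finally show ?thesis
      unfolding measure_def
      by (subst integral_mixed_partial_cbox(2)[symmetric, OF f ks])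
        (auto simp: nonneg intro!: enn2real_ennreal integral_nonneg)
  qed
  then have "(\<lambda>k. measure M (A k)) \<longlonglongrightarrow> f (override_vec (set ks) 0 (($) b))"
    using box_diff_tendsto[where f = f and g = g and b = b and y = 0, OF ks(1) bound lim] by simp
  also have "override_vec (set ks) 0 (($) b) = b"
    by (simp add: ks vec_eq_iff override_vec_nth)
  finally have 1: "(\<lambda>k. measure M (A k)) \<longlonglongrightarrow> f b" .
  have "incseq A"
  proof (intro monoI subsetI)
    fix m n \<omega> assume "m \<le> n" "\<omega> \<in> A m"
    then have "b $ i - real n \<le> \<epsilon> \<omega> $ i" for i
      unfolding A_def by (auto simp: mem_box_cart intro: order_trans[of _ "b $ i - real m"])
    then show "\<omega> \<in> A n"
      using \<open>\<omega> \<in> A m\<close> by (auto simp: A_def mem_box_cart)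
  qed
  moreover have "range A \<subseteq> sets M"
    by (auto simp: A_def)
  ultimately have "(\<lambda>k. measure M (A k)) \<longlonglongrightarrow> measure M (\<Union>k. A k)"
    by (intro finite_Lim_measure_incseq)
  moreover have "(\<Union>k. A k) = {\<omega> \<in> space M. \<forall>i. \<epsilon> \<omega> $ i \<le> b $ i}"
  proof (intro set_eqI iffI)
    fix \<omega> assume \<omega>: "\<omega> \<in> {\<omega> \<in> space M. \<forall>i. \<epsilon> \<omega> $ i \<le> b $ i}"
    obtain k :: nat where "norm (b - \<epsilon> \<omega>) \<le> real k"
      using real_arch_simple by blast
    then have "b $ i - \<epsilon> \<omega> $ i \<le> real k" for i
      using component_le_norm_cart[of "b - \<epsilon> \<omega>" i] by simp
    then have "\<omega> \<in> A k"
      using \<omega> unfolding A_def by (auto simp: mem_box_cart algebra_simps)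
    then show "\<omega> \<in> (\<Union>k. A k)" by blast
  qed (auto simp: A_def mem_box_cart)
  ultimately show ?thesis
    using LIMSEQ_unique[OF 1] by simp
qed

section \<open>The surplus of a homogeneous extreme value model\<close>

text \<open>Homogeneity of \<open>G\<close> makes the maximum of \<open>u $ i + \<epsilon> $ i\<close> at \<open>u\<close> equal in law to a
  translate of the maximum at \<open>0\<close>.  Comparing the two expectations gives the surplus up to its
  value at \<open>0\<close>, so the Gumbel mean need not be computed.\<close>

lemma surplus_eq_ln:
  fixes G :: "real ^ 'n \<Rightarrow> real"
  assumes "prob_space M" and int: "integrable M \<epsilon>"
    and "0 < \<mu>"
    and cdf: "\<And>b. measure M {\<omega> \<in> space M. \<forall>i. \<epsilon> \<omega> $ i \<le> b $ i} = exp (- G (\<chi> i. exp (- b $ i)))"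
    and hom: "\<And>c u. 0 < c \<Longrightarrow> G (\<chi> i. c * exp (u $ i)) = c powr (1 / \<mu>) * G (\<chi> i. exp (u $ i))"
    and pos: "\<And>u. 0 < G (\<chi> i. exp (u $ i))"
  shows "surplus M \<epsilon> u = surplus M \<epsilon> 0 + \<mu> * (ln (G (\<chi> i. exp (u $ i))) - ln (G (\<chi> i. exp (0 $ i))))"
proof -
  interpret prob_space M by fact
  define X where "X u \<omega> = Max (range (\<lambda>i. u $ i + \<epsilon> \<omega> $ i))" for u \<omega>
  define G' where "G' u = G (\<chi> i. exp (u $ i))" for u
  define c where "c = \<mu> * (ln (G' u) - ln (G' 0))"
  have [measurable]: "\<epsilon> \<in> borel_measurable M"
    using int by simp
  have surplus_X: "surplus M \<epsilon> v = (\<integral>\<omega>. X v \<omega> \<partial>M)" for v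
    by (simp only: surplus_def X_def)
  have X_le: "X u \<omega> \<le> t \<longleftrightarrow> (\<forall>i. \<epsilon> \<omega> $ i \<le> (\<chi> i. t - u $ i) $ i)" for u \<omega> t
    unfolding X_def by (subst Max_le_iff) (auto simp: algebra_simps)
  have [measurable]: "X u \<in> borel_measurable M" for u
    unfolding borel_measurable_iff_le X_le by measurable
  have cdf_X: "measure M {\<omega> \<in> space M. X u \<omega> \<le> t} = exp (- (exp (- t / \<mu>) * G' u))" for u t
  proof -
    have "measure M {\<omega> \<in> space M. X u \<omega> \<le> t} = exp (- G (\<chi> i. exp (- (\<chi> i. t - u $ i) $ i)))"
      unfolding X_le by (rule cdf)
    also have "(\<chi> i. exp (- (\<chi> i. t - u $ i) $ i)) = (\<chi> i. exp (- t) * exp (u $ i))"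
      by (simp add: vec_eq_iff flip: exp_add)
    finally show ?thesis
      by (simp add: hom G'_def exp_powr_real)
  qed
  have "G' u > 0" "G' 0 > 0"
    using pos by (simp_all only: G'_def)
  then have ec: "exp (c / \<mu>) = G' u / G' 0"
    using \<open>0 < \<mu>\<close> by (simp add: c_def exp_diff)
  have "distr M borel (X u) = distr M borel (\<lambda>\<omega>. X 0 \<omega> + c)"
  proof (rule cdf_unique)
    show "real_distribution (distr M borel (X u))" "real_distribution (distr M borel (\<lambda>\<omega>. X 0 \<omega> + c))"
      by (auto intro!: real_distribution_distr)
    show "cdf (distr M borel (X u)) = cdf (distr M borel (\<lambda>\<omega>. X 0 \<omega> + c))"
    proof
      fix t
      have *: "{\<omega> \<in> space M. X 0 \<omega> + c \<le> t} = {\<omega> \<in> space M. X 0 \<omega> \<le> t - c}"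
        by auto
      have "exp (- (t - c) / \<mu>) = exp (- t / \<mu>) * exp (c / \<mu>)"
        by (simp add: diff_divide_distrib flip: exp_add)
      then have "exp (- (t - c) / \<mu>) * G' 0 = exp (- t / \<mu>) * G' u"
        using ec \<open>G' 0 > 0\<close> by simp
      then have "measure M {\<omega> \<in> space M. X u \<omega> \<le> t} = measure M {\<omega> \<in> space M. X 0 \<omega> + c \<le> t}"
        unfolding * cdf_X by simp
      then show "cdf (distr M borel (X u)) t = cdf (distr M borel (\<lambda>\<omega>. X 0 \<omega> + c)) t"
        by (simp add: cdf_def measure_distr vimage_def Int_def conj_commute)
    qed
  qed
  note same_distr = this
  have "integrable M (X 0)"
  proof (rule Bochner_Integration.integrable_bound[OF int])
    have "X 0 \<omega> \<in> range (\<lambda>i. 0 $ i + \<epsilon> \<omega> $ i)" for \<omega>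
      unfolding X_def by (intro Max_in) auto
    then have "norm (X 0 \<omega>) \<le> norm (\<epsilon> \<omega>)" for \<omega>
      using component_le_norm_cart[of "\<epsilon> \<omega>"] by (smt (verit) imageE real_norm_def zero_index)
    then show "AE \<omega> in M. norm (X 0 \<omega>) \<le> norm (\<epsilon> \<omega>)"
      by simp
  qed simp
  then have "(\<integral>\<omega>. X 0 \<omega> + c \<partial>M) = surplus M \<epsilon> 0 + c"
    by (simp add: prob_space surplus_X)
  moreover have "surplus M \<epsilon> u = (\<integral>x. x \<partial>distr M borel (X u))"
    by (simp add: integral_distr surplus_X)
  moreover have "\<dots> = (\<integral>\<omega>. X 0 \<omega> + c \<partial>M)"
    unfolding same_distr by (simp add: integral_distr)
  ultimately show ?thesis
    by (simp only: c_def G'_def)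
qed

section \<open>Strong convexity of the conjugate of a smooth function\<close>

lemma convex_conjugate_finite:
  assumes "\<And>u. p \<bullet> u - E u \<le> C"
  shows "\<bar>convex_conjugate E p\<bar> \<noteq> \<infinity>"
proof -
  have "ereal (p \<bullet> 0 - E 0) \<le> convex_conjugate E p"
    unfolding convex_conjugate_def by (rule SUP_upper) simp
  moreover have "convex_conjugate E p \<le> ereal C"
    unfolding convex_conjugate_def using assms by (intro SUP_least) simp
  ultimately show ?thesis by auto
qed

text \<open>The hypothesis \<open>smooth\<close> says that on a segment with direction \<open>s\<close> the value of \<open>E\<close> lies below
  the chord by at most \<open>\<alpha> (1 - \<alpha>) / (2 \<beta>)\<close> times the square of the maximum norm of \<open>s\<close>.  This is
  \<open>1 / \<beta>\<close>-smoothness in the maximum norm; it yields strong convexity of the conjugate in the dual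
  norm.\<close>

lemma strongly_convex_conjugate:
  fixes E :: "real ^ 'n \<Rightarrow> real"
  assumes "0 < \<beta>"
    and smooth: "\<And>w s \<alpha> S. \<lbrakk>0 \<le> \<alpha>; \<alpha> \<le> 1; \<And>i. \<bar>s $ i\<bar> \<le> S\<rbrakk> \<Longrightarrow>
      \<alpha> * E (w + (1 - \<alpha>) *\<^sub>R s) + (1 - \<alpha>) * E (w - \<alpha> *\<^sub>R s) - \<alpha> * (1 - \<alpha>) * S\<^sup>2 / (2 * \<beta>) \<le> E w"
    and finite: "\<And>p. p \<in> prob_simplex \<Longrightarrow> \<bar>convex_conjugate E p\<bar> \<noteq> \<infinity>"
  shows "strongly_convex_l1 \<beta> (convex_conjugate E)"
  unfolding strongly_convex_l1_def
proof (intro conjI ballI)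
  fix p q :: "real ^ 'n" and \<alpha> :: real
  assume p: "p \<in> prob_simplex" and q: "q \<in> prob_simplex" and \<alpha>: "\<alpha> \<in> {0..1}"
  obtain P where P: "convex_conjugate E p = ereal P"
    using finite[OF p] by (cases "convex_conjugate E p") auto
  obtain Q where Q: "convex_conjugate E q = ereal Q"
    using finite[OF q] by (cases "convex_conjugate E q") auto
  let ?N = "l1_norm (p - q)"
  \<comment> \<open>\<open>s\<close> maximises \<open>(p - q) \<bullet> s - S\<^sup>2 / (2 * \<beta>)\<close>, where \<open>S\<close> is the maximum norm of \<open>s\<close>.\<close>
  define s :: "real ^ 'n" where "s = (\<chi> i. \<beta> * ?N * sgn ((p - q) $ i))"
  have N: "0 \<le> ?N"
    by (simp add: l1_norm_def sum_nonneg)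
  have s_le: "\<bar>s $ i\<bar> \<le> \<beta> * ?N" for i
    using N \<open>0 < \<beta>\<close> by (simp add: s_def abs_mult sgn_if)
  have pair: "(p - q) \<bullet> s = \<beta> * ?N\<^sup>2"
  proof -
    have "(p - q) \<bullet> s = (\<Sum>i\<in>UNIV. \<beta> * ?N * \<bar>(p - q) $ i\<bar>)"
      unfolding inner_vec_def by (intro sum.cong) (auto simp: s_def sgn_if)
    then show ?thesis
      by (simp add: l1_norm_def power2_eq_square flip: sum_distrib_left)
  qed
  \<comment> \<open>Test the suprema at \<open>p\<close> and \<open>q\<close> with two points whose convex combination is \<open>w\<close> and
    whose difference is \<open>s\<close>.\<close>
  have "(\<alpha> *\<^sub>R p + (1 - \<alpha>) *\<^sub>R q) \<bullet> w - E w \<le>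
      \<alpha> * P + (1 - \<alpha>) * Q - \<beta> / 2 * \<alpha> * (1 - \<alpha>) * ?N\<^sup>2" for w
  proof -
    let ?D = "\<beta> / 2 * \<alpha> * (1 - \<alpha>) * ?N\<^sup>2"
    let ?u = "w + (1 - \<alpha>) *\<^sub>R s" and ?v = "w - \<alpha> *\<^sub>R s"
    have "ereal (p \<bullet> ?u - E ?u) \<le> ereal P" "ereal (q \<bullet> ?v - E ?v) \<le> ereal Q"
      unfolding P[symmetric] Q[symmetric] convex_conjugate_def by (auto intro: SUP_upper)
    then have "\<alpha> * (p \<bullet> ?u - E ?u) + (1 - \<alpha>) * (q \<bullet> ?v - E ?v) \<le> \<alpha> * P + (1 - \<alpha>) * Q"
      using \<alpha> by (intro add_mono mult_left_mono) auto
    moreover have "\<alpha> * E ?u + (1 - \<alpha>) * E ?v - \<alpha> * (1 - \<alpha>) * (\<beta> * ?N)\<^sup>2 / (2 * \<beta>) \<le> E w"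
      using \<alpha> s_le by (intro smooth) auto
    moreover have "\<alpha> * (p \<bullet> ?u) + (1 - \<alpha>) * (q \<bullet> ?v) =
        (\<alpha> *\<^sub>R p + (1 - \<alpha>) *\<^sub>R q) \<bullet> w + \<alpha> * (1 - \<alpha>) * ((p - q) \<bullet> s)"
      by (simp add: inner_simps algebra_simps)
    moreover have "\<alpha> * (1 - \<alpha>) * ((p - q) \<bullet> s) = 2 * ?D"
      unfolding pair by simp
    moreover have "\<alpha> * (1 - \<alpha>) * (\<beta> * ?N)\<^sup>2 / (2 * \<beta>) = ?D"
      using \<open>0 < \<beta>\<close> by (simp add: power2_eq_square)
    ultimately show ?thesis
      by (simp only: right_diff_distrib)
  qed
  then show "convex_conjugate E (\<alpha> *\<^sub>R p + (1 - \<alpha>) *\<^sub>R q) \<le>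
      ereal \<alpha> * convex_conjugate E p + ereal (1 - \<alpha>) * convex_conjugate E q
        - ereal (\<beta> / 2 * \<alpha> * (1 - \<alpha>) * ?N\<^sup>2)"
    unfolding P Q by (subst convex_conjugate_def) (auto intro: SUP_least)
qed (use assms in auto)

section \<open>A differential inequality for sums of exponentials\<close>

text \<open>The differential inequality \<open>f'' \<le> C f\<close> on the real line.  For positive \<open>f\<close> it bounds the second
  derivative of \<open>ln f\<close> by \<open>C\<close>; unlike that bound, it is linear in \<open>f\<close> and hence passes to sums.\<close>

definition log_growth :: "real \<Rightarrow> (real \<Rightarrow> real) \<Rightarrow> bool" where
  "log_growth C f \<longleftrightarrow> (\<exists>f' f''. \<forall>t. (f has_real_derivative f' t) (at t) \<and>
     (f' has_real_derivative f'' t) (at t) \<and> f'' t \<le> C * f t)"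

lemma log_growth_mono:
  assumes "log_growth C f" and "\<And>t. 0 \<le> f t" and "C \<le> D"
  shows "log_growth D f"
  using assms(1) mult_right_mono[OF assms(3,2)]
  unfolding log_growth_def by (meson order_trans)

lemma log_growth_sum:
  assumes "\<And>l. l \<in> A \<Longrightarrow> log_growth C (f l)"
  shows "log_growth C (\<lambda>t. \<Sum>l\<in>A. f l t)"
proof -
  from assms obtain f' f'' where "\<And>l t. l \<in> A \<Longrightarrow> (f l has_real_derivative f' l t) (at t) \<and>
      (f' l has_real_derivative f'' l t) (at t) \<and> f'' l t \<le> C * f l t"
    unfolding log_growth_def by metis
  then show ?thesis
    unfolding log_growth_def
    by (intro exI[of _ "\<lambda>t. \<Sum>l\<in>A. f' l t"] exI[of _ "\<lambda>t. \<Sum>l\<in>A. f'' l t"])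
      (auto intro!: DERIV_sum sum_mono simp: sum_distrib_left)
qed

text \<open>The exponent lies between \<open>0\<close> and \<open>1\<close>, so the term with the square of \<open>f'\<close> is nonpositive.\<close>

lemma log_growth_powr:
  assumes "log_growth C f" and pos: "\<And>t. 0 < f t" and "0 \<le> \<theta>" "\<theta> \<le> 1"
  shows "log_growth (\<theta> * C) (\<lambda>t. f t powr \<theta>)"
proof -
  from assms(1) obtain f' f'' where f:
    "\<And>t. (f has_real_derivative f' t) (at t)" "\<And>t. (f' has_real_derivative f'' t) (at t)"
    "\<And>t. f'' t \<le> C * f t"
    unfolding log_growth_def by metis
  let ?g' = "\<lambda>t. \<theta> * f t powr (\<theta> - 1) * f' t"
  let ?g'' = "\<lambda>t. \<theta> * ((\<theta> - 1) * f t powr (\<theta> - 2) * f' t) * f' t + \<theta> * f t powr (\<theta> - 1) * f'' t"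
  have "((\<lambda>t. f t powr \<theta>) has_real_derivative ?g' t) (at t)" for t
    using DERIV_fun_powr[OF f(1) pos, of \<theta>] by simp
  moreover have "(?g' has_real_derivative ?g'' t) (at t)" for t
    using DERIV_mult[OF DERIV_cmult[OF DERIV_fun_powr[OF f(1) pos, of "\<theta> - 1"], of \<theta>] f(2)[of t]]
    by (simp add: algebra_simps)
  moreover have "?g'' t \<le> \<theta> * C * f t powr \<theta>" for t
  proof -
    have "\<theta> * ((\<theta> - 1) * f t powr (\<theta> - 2) * f' t) * f' t = - (\<theta> * (1 - \<theta>) * f t powr (\<theta> - 2) * (f' t)\<^sup>2)"
      by (simp add: power2_eq_square algebra_simps)
    also have "\<dots> \<le> 0"
      using assms by simp
    finally have "?g'' t \<le> \<theta> * f t powr (\<theta> - 1) * f'' t"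
      by simp
    also have "\<dots> \<le> \<theta> * f t powr (\<theta> - 1) * (C * f t)"
      using assms f(3) by (intro mult_left_mono) auto
    also have "\<dots> = \<theta> * C * f t powr \<theta>"
      using pos[of t] by (simp add: powr_diff)
    finally show ?thesis .
  qed
  ultimately show ?thesis
    unfolding log_growth_def by (intro exI[of _ ?g'] exI[of _ ?g'']) blast
qed

lemma concave_on_ln_log_growth:
  assumes "log_growth C f" and pos: "\<And>t. 0 < f t" and "0 \<le> \<mu>"
  shows "concave_on UNIV (\<lambda>t. \<mu> * ln (f t) - \<mu> * C / 2 * t\<^sup>2)"
proof -
  from assms(1) obtain f' f'' where f:
    "\<And>t. (f has_real_derivative f' t) (at t)" "\<And>t. (f' has_real_derivative f'' t) (at t)"
    "\<And>t. f'' t \<le> C * f t"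
    unfolding log_growth_def by metis
  show ?thesis
  proof (rule f''_le0_imp_concave)
    fix t
    show "((\<lambda>t. \<mu> * ln (f t) - \<mu> * C / 2 * t\<^sup>2) has_real_derivative
        \<mu> * (f' t / f t) - \<mu> * C * t) (at t)"
      using pos[of t] by (auto intro!: derivative_eq_intros f(1))
    show "((\<lambda>t. \<mu> * (f' t / f t) - \<mu> * C * t) has_real_derivative
        \<mu> * ((f'' t * f t - f' t * f' t) / (f t * f t)) - \<mu> * C) (at t)"
      using pos[of t] by (auto intro!: derivative_eq_intros f(1,2) simp: algebra_simps)
    have "f'' t * f t - f' t * f' t \<le> C * f t * f t"
      using mult_right_mono[OF f(3)[of t], of "f t"] pos[of t] by (smt (verit) zero_le_square)
    then have "(f'' t * f t - f' t * f' t) / (f t * f t) \<le> C"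
      using pos[of t] by (simp add: divide_le_eq mult.assoc)
    then show "\<mu> * ((f'' t * f t - f' t * f' t) / (f t * f t)) - \<mu> * C \<le> 0"
      using mult_left_mono[OF _ \<open>0 \<le> \<mu>\<close>] by force
  qed simp
qed

lemma log_growth_exp_sum:
  fixes a r :: "'i \<Rightarrow> real"
  assumes "\<And>i. i \<in> I \<Longrightarrow> 0 \<le> a i" and "\<And>i. i \<in> I \<Longrightarrow> \<bar>r i\<bar> \<le> R"
  shows "log_growth (R\<^sup>2) (\<lambda>t. \<Sum>i\<in>I. a i * exp (t * r i))"
proof (rule log_growth_sum)
  fix i assume i: "i \<in> I"
  have "a i * (r i)\<^sup>2 * exp (t * r i) \<le> R\<^sup>2 * (a i * exp (t * r i))" for t
  proof -
    have "(r i)\<^sup>2 \<le> R\<^sup>2"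
      using assms(2)[OF i] by (metis abs_le_square_iff abs_of_nonneg abs_ge_zero order_trans)
    then have "(r i)\<^sup>2 * (a i * exp (t * r i)) \<le> R\<^sup>2 * (a i * exp (t * r i))"
      using assms(1)[OF i] by (intro mult_right_mono) auto
    then show ?thesis by (simp add: mult_ac)
  qed
  then show "log_growth (R\<^sup>2) (\<lambda>t. a i * exp (t * r i))"
    unfolding log_growth_def
    by (intro exI[of _ "\<lambda>t. a i * r i * exp (t * r i)"] exI[of _ "\<lambda>t. a i * (r i)\<^sup>2 * exp (t * r i)"])
      (auto intro!: derivative_eq_intros simp: power2_eq_square)
qed

section \<open>The generating function of the generalized nested logit model\<close>

text \<open>In nest \<open>l\<close> the inner sum has constant \<open>(S / \<mu>n l)\<^sup>2\<close>; the outer exponent multiplies it by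
  \<open>\<mu>n l / \<mu>\<close>, leaving \<open>S\<^sup>2 / (\<mu> * \<mu>n l)\<close>.\<close>

lemma log_growth_gnl:
  assumes nests: "\<And>l. l \<in> L \<Longrightarrow> m \<le> \<mu>n l \<and> \<mu>n l \<le> \<mu>" and "0 < m"
    and nonneg: "\<And>i l. l \<in> L \<Longrightarrow> 0 \<le> \<sigma> i l"
    and S: "\<And>i. \<bar>s $ i\<bar> \<le> S"
  shows "log_growth (S\<^sup>2 / (\<mu> * m)) (\<lambda>t. gnl_generator L \<mu> \<mu>n \<sigma> (\<chi> i. exp ((w + t *\<^sub>R s) $ i)))"
  unfolding gnl_generator_def
proof (rule log_growth_sum)
  fix l assume l: "l \<in> L"
  let ?k = "1 / \<mu>n l" and ?\<theta> = "\<mu>n l / \<mu>"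
  let ?A = "\<lambda>t. \<Sum>i\<in>UNIV. \<sigma> i l powr ?k * exp (w $ i * ?k) * exp (t * (s $ i * ?k))"
  have pos: "0 < \<mu>n l" "0 < \<mu>" "\<mu>n l \<le> \<mu>" "m \<le> \<mu>n l"
    using nests[OF l] \<open>0 < m\<close> by auto
  have eq: "?\<theta> * (S * ?k)\<^sup>2 = S\<^sup>2 / (\<mu> * \<mu>n l)"
    using pos by (simp add: power2_eq_square field_simps)
  have le: "S\<^sup>2 / (\<mu> * \<mu>n l) \<le> S\<^sup>2 / (\<mu> * m)"
    using pos \<open>0 < m\<close> by (intro divide_left_mono mult_left_mono) auto
  have summand: "(\<sigma> i l * (\<chi> i. exp ((w + t *\<^sub>R s) $ i)) $ i) powr ?k =
      \<sigma> i l powr ?k * exp (w $ i * ?k) * exp (t * (s $ i * ?k))" for i t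
    using nonneg[OF l, of i]
    by (simp add: powr_mult exp_powr_real add_divide_distrib flip: exp_add)
  show "log_growth (S\<^sup>2 / (\<mu> * m)) (\<lambda>t. (\<Sum>i\<in>UNIV. (\<sigma> i l * (\<chi> i. exp ((w + t *\<^sub>R s) $ i)) $ i) powr ?k) powr ?\<theta>)"
    unfolding summand
  proof (cases "\<forall>i. \<sigma> i l = 0")
    \<comment> \<open>A nest to which no alternative is attached contributes \<open>0\<close>; its inner sum is not positive,
      so \<open>log_growth_powr\<close> does not cover it.\<close>
    case True
    then show "log_growth (S\<^sup>2 / (\<mu> * m)) (\<lambda>t. ?A t powr ?\<theta>)"
      by (simp add: log_growth_def) (intro exI[of _ "\<lambda>_. 0"]; simp)
  next
    case False
    then obtain i where "\<sigma> i l \<noteq> 0" by blast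
    then have Apos: "0 < ?A t" for t
      by (intro sum_pos2[where i = i]) auto
    have "log_growth ((S * ?k)\<^sup>2) ?A"
      using S pos by (intro log_growth_exp_sum) (auto simp: divide_right_mono abs_mult)
    then have "log_growth (?\<theta> * (S * ?k)\<^sup>2) (\<lambda>t. ?A t powr ?\<theta>)"
      using pos Apos by (intro log_growth_powr) auto
    then have "log_growth (S\<^sup>2 / (\<mu> * \<mu>n l)) (\<lambda>t. ?A t powr ?\<theta>)"
      using pos by (simp only: eq)
    then show "log_growth (S\<^sup>2 / (\<mu> * m)) (\<lambda>t. ?A t powr ?\<theta>)"
      by (rule log_growth_mono[OF _ powr_ge_zero le])
  qed
qed

lemma gnl_generator_homogeneous:
  assumes "0 \<le> c" and "\<And>i. 0 \<le> x $ i"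
    and "\<And>l. l \<in> L \<Longrightarrow> 0 < \<mu>n l" and "\<And>i l. l \<in> L \<Longrightarrow> 0 \<le> \<sigma> i l"
  shows "gnl_generator L \<mu> \<mu>n \<sigma> (\<chi> i. c * x $ i) = c powr (1 / \<mu>) * gnl_generator L \<mu> \<mu>n \<sigma> x"
  unfolding gnl_generator_def sum_distrib_left
proof (rule sum.cong)
  fix l assume l: "l \<in> L"
  have "(\<sigma> i l * (\<chi> i. c * x $ i) $ i) powr (1 / \<mu>n l) =
      c powr (1 / \<mu>n l) * (\<sigma> i l * x $ i) powr (1 / \<mu>n l)" for i
    using assms l by (simp add: mult.left_commute[of _ c] powr_mult)
  then show "(\<Sum>i\<in>UNIV. (\<sigma> i l * (\<chi> i. c * x $ i) $ i) powr (1 / \<mu>n l)) powr (\<mu>n l / \<mu>) =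
      c powr (1 / \<mu>) * (\<Sum>i\<in>UNIV. (\<sigma> i l * x $ i) powr (1 / \<mu>n l)) powr (\<mu>n l / \<mu>)"
    using assms(3)[OF l]
    by (simp only: sum_distrib_left[symmetric]) (simp add: powr_mult sum_nonneg powr_powr)
qed simp

lemma gnl_generator_ge:
  assumes "finite L" and "0 < \<mu>" and "l \<in> L" and "0 < \<mu>n l"
    and nonneg: "\<And>i l. l \<in> L \<Longrightarrow> 0 \<le> \<sigma> i l" "\<And>i. 0 \<le> x $ i"
  shows "(\<sigma> i l * x $ i) powr (1 / \<mu>) \<le> gnl_generator L \<mu> \<mu>n \<sigma> x"
proof -
  have "(\<sigma> i l * x $ i) powr (1 / \<mu>) = ((\<sigma> i l * x $ i) powr (1 / \<mu>n l)) powr (\<mu>n l / \<mu>)"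
    using assms by (simp add: powr_powr)
  also have "\<dots> \<le> (\<Sum>i\<in>UNIV. (\<sigma> i l * x $ i) powr (1 / \<mu>n l)) powr (\<mu>n l / \<mu>)"
    using assms by (intro powr_mono2 member_le_sum) auto
  also have "\<dots> \<le> gnl_generator L \<mu> \<mu>n \<sigma> x"
    unfolding gnl_generator_def using assms
    by (intro member_le_sum[where f = "\<lambda>l. (\<Sum>i\<in>UNIV. (\<sigma> i l * x $ i) powr (1 / \<mu>n l)) powr (\<mu>n l / \<mu>)"]) auto
  finally show ?thesis .
qed

lemma smooth_expr_gnl:
  assumes "\<And>i l. l \<in> L \<Longrightarrow> 0 \<le> \<sigma> i l"
  shows "smooth_expr (\<lambda>y. gnl_generator L \<mu> \<mu>n \<sigma> (\<chi> i. exp (- y $ i)))"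
  unfolding gnl_generator_def
proof (rule smooth_expr_sum)
  fix l assume l: "l \<in> L"
  let ?term = "\<lambda>i y. (\<sigma> i l * (\<chi> i. exp (- y $ i)) $ i) powr (1 / \<mu>n l)"
  show "smooth_expr (\<lambda>y. (\<Sum>i\<in>UNIV. ?term i y) powr (\<mu>n l / \<mu>))"
  proof (cases "\<forall>i. \<sigma> i l = 0")
    case True
    then show ?thesis by (simp add: smooth_expr.const)
  next
    case False
    then obtain j where j: "\<sigma> j l \<noteq> 0" by blast
    have summand: "smooth_expr (?term i)" for i
    proof (cases "\<sigma> i l = 0")
      case True
      then show ?thesis by (simp add: smooth_expr.const)
    next
      case False
      then have "0 < \<sigma> i l"
        using assms[OF l, of i] by simp
      then show ?thesis
        by (auto intro!: smooth_expr.powr smooth_expr.mult smooth_expr.const smooth_expr.exp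
            smooth_expr_uminus smooth_expr.coord)
    qed
    have pos: "0 < (\<Sum>i\<in>UNIV. ?term i y)" for y
      using j by (intro sum_pos2[where i = j]) auto
    show ?thesis
      by (rule smooth_expr.powr[OF smooth_expr_sum[OF summand] pos])
  qed
qed

section \<open>Strong convexity for the generalized nested logit model\<close>

theorem corollary4:
  fixes L :: "'l set" and \<mu> :: real and \<mu>n :: "'l \<Rightarrow> real"
    and \<sigma> :: "'n::finite \<Rightarrow> 'l \<Rightarrow> real" and ks :: "'n list"
    and M :: "'a measure" and \<epsilon> :: "'a \<Rightarrow> real ^ 'n"
  assumes "finite L" and "L \<noteq> {}"
    and "0 < \<mu>"
    and "\<And>l. l \<in> L \<Longrightarrow> 0 < \<mu>n l \<and> \<mu>n l \<le> \<mu>"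
    and "\<And>i l. l \<in> L \<Longrightarrow> 0 \<le> \<sigma> i l"
    and "\<And>i. (\<Sum>l\<in>L. \<sigma> i l) = 1"
    and "generalized_extreme_value ks (gnl_generator L \<mu> \<mu>n \<sigma>) M \<epsilon>"
  shows "strongly_convex_l1 (1 / (2 / Min (\<mu>n ` L) - 1 / \<mu>)) (convex_conjugate (surplus M \<epsilon>))"
proof -
  let ?G = "gnl_generator L \<mu> \<mu>n \<sigma>" and ?m = "Min (\<mu>n ` L)"
  let ?E = "surplus M \<epsilon>"
  define \<beta> where "\<beta> = 1 / (2 / ?m - 1 / \<mu>)"
  define H where "H u = ?G (\<chi> i. exp (u $ i))" for u :: "real ^ 'n"
  note nests = assms(4) and \<sigma>_nonneg = assms(5)
  have M: "prob_space M" "integrable M \<epsilon>" and ks: "distinct ks" "set ks = UNIV"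
    and dens: "\<And>y. 0 \<le> gev_density ks ?G y"
      "distributed M lborel \<epsilon> (\<lambda>y. ennreal (gev_density ks ?G y))"
    using assms(7) by (auto simp: generalized_extreme_value_def additive_random_utility_def)

  have m: "0 < ?m" "?m \<le> \<mu>" and m_le: "\<And>l. l \<in> L \<Longrightarrow> ?m \<le> \<mu>n l"
    using assms(1-3) nests by (auto simp: Min_le_iff Min_gr_iff)
  have "1 / \<mu> \<le> 1 / ?m"
    using m by (intro divide_left_mono) auto
  \<comment> \<open>The surplus is even \<open>1 / ?m\<close>-smooth, and this constant is at most \<open>1 / \<beta>\<close>.\<close>
  then have \<beta>: "0 < \<beta>" "1 / ?m \<le> 1 / \<beta>"
    using m by (auto simp: \<beta>_def field_simps)

  have "\<exists>l\<in>L. 0 < \<sigma> i l" for i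
  proof (rule ccontr)
    assume "\<not> (\<exists>l\<in>L. 0 < \<sigma> i l)"
    then have "(\<Sum>l\<in>L. \<sigma> i l) \<le> 0"
      by (intro sum_nonpos) (auto simp: not_less)
    then show False using assms(6)[of i] by simp
  qed
  then obtain l where l: "\<And>i. l i \<in> L" "\<And>i. 0 < \<sigma> i (l i)"
    by metis
  define c where "c i = \<sigma> i (l i)" for i
  have c: "0 < c i" for i
    using l by (simp add: c_def)
  have H_ge: "(c i * exp (u $ i)) powr (1 / \<mu>) \<le> H u" for i u
    using gnl_generator_ge[of L \<mu> "l i" \<mu>n \<sigma> "\<chi> i. exp (u $ i)" i] assms(1,3) nests \<sigma>_nonneg l
    by (simp add: H_def c_def)
  have H_pos: "0 < H u" for u
    by (rule less_le_trans[OF _ H_ge[of undefined u]]) (simp add: c less_imp_neq[OF c, symmetric])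

  \<comment> \<open>\<open>H_ge\<close> makes \<open>exp (- H (- z))\<close> decay as any one coordinate of \<open>z\<close> tends to minus infinity.\<close>
  have cdf: "measure M {\<omega> \<in> space M. \<forall>i. \<epsilon> \<omega> $ i \<le> b $ i} = exp (- ?G (\<chi> i. exp (- b $ i)))" for b
  proof (rule cdf_of_mixed_partial_density[where g = "\<lambda>i t. exp (- ((c i * exp (- t)) powr (1 / \<mu>)))"])
    show "smooth_expr (\<lambda>y. exp (- ?G (\<chi> i. exp (- y $ i))))"
      by (intro smooth_expr.exp smooth_expr_uminus smooth_expr_gnl \<sigma>_nonneg)
    show "\<bar>exp (- ?G (\<chi> i. exp (- z $ i)))\<bar> \<le> exp (- ((c i * exp (- z $ i)) powr (1 / \<mu>)))" for i z
      using H_ge[of i "- z"] by (simp add: H_def)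
    show "((\<lambda>t. exp (- ((c i * exp (- t)) powr (1 / \<mu>)))) \<longlongrightarrow> 0) at_bot" for i
      using c[of i] \<open>0 < \<mu>\<close> by real_asymp
  qed (use M ks dens in \<open>auto simp: gev_density_def\<close>)

  have E_eq: "?E u = ?E 0 + \<mu> * (ln (H u) - ln (H 0))" for u
    unfolding H_def
  proof (rule surplus_eq_ln[OF M \<open>0 < \<mu>\<close> cdf])
    show "?G (\<chi> i. k * exp (u $ i)) = k powr (1 / \<mu>) * ?G (\<chi> i. exp (u $ i))" if "0 < k" for k u
      using gnl_generator_homogeneous[of k "\<chi> i. exp (u $ i)" L \<mu>n \<sigma> \<mu>] that nests \<sigma>_nonneg
      by simp
    show "0 < ?G (\<chi> i. exp (u $ i))" for u
      using H_pos by (simp add: H_def)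
  qed

  show ?thesis
    unfolding \<beta>_def[symmetric]
  proof (rule strongly_convex_conjugate[OF \<beta>(1)])
    fix w s :: "real ^ 'n" and \<alpha> S :: real
    assume \<alpha>: "0 \<le> \<alpha>" "\<alpha> \<le> 1" and S: "\<And>i. \<bar>s $ i\<bar> \<le> S"
    have quad: "\<alpha> * (K / 2 * (1 - \<alpha>)\<^sup>2) + (1 - \<alpha>) * (K / 2 * (- \<alpha>)\<^sup>2) =
        \<alpha> * (1 - \<alpha>) * K / 2" for K
      by (simp add: power2_eq_square field_simps)
    \<comment> \<open>Concavity of \<open>?\<psi>\<close> is used at \<open>- \<alpha>\<close> and \<open>1 - \<alpha>\<close>, whose combination with weights \<open>1 - \<alpha>\<close>
      and \<open>\<alpha>\<close> is \<open>0\<close>.\<close>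
    let ?\<psi> = "\<lambda>t. \<mu> * ln (H (w + t *\<^sub>R s)) - \<mu> * (S\<^sup>2 / (\<mu> * ?m)) / 2 * t\<^sup>2"
    have "log_growth (S\<^sup>2 / (\<mu> * ?m)) (\<lambda>t. H (w + t *\<^sub>R s))"
      unfolding H_def using m(1) m_le nests \<sigma>_nonneg S by (intro log_growth_gnl) auto
    then have "concave_on UNIV ?\<psi>"
      using H_pos \<open>0 < \<mu>\<close> by (intro concave_on_ln_log_growth) auto
    then have "(1 - \<alpha>) * ?\<psi> (- \<alpha>) + \<alpha> * ?\<psi> (1 - \<alpha>) \<le> ?\<psi> ((1 - \<alpha>) *\<^sub>R (- \<alpha>) + \<alpha> *\<^sub>R (1 - \<alpha>))"
      using \<alpha> by (intro concave_onD) auto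
    moreover have "(1 - \<alpha>) *\<^sub>R (- \<alpha>) + \<alpha> *\<^sub>R (1 - \<alpha>) = 0"
      by (simp add: algebra_simps)
    moreover have "\<mu> * (S\<^sup>2 / (\<mu> * ?m)) / 2 = S\<^sup>2 / ?m / 2"
      using \<open>0 < \<mu>\<close> by simp
    ultimately have "(1 - \<alpha>) * (\<mu> * ln (H (w - \<alpha> *\<^sub>R s)) - S\<^sup>2 / ?m / 2 * (- \<alpha>)\<^sup>2) +
        \<alpha> * (\<mu> * ln (H (w + (1 - \<alpha>) *\<^sub>R s)) - S\<^sup>2 / ?m / 2 * (1 - \<alpha>)\<^sup>2) \<le> \<mu> * ln (H w)"
      by simp
    moreover have "\<alpha> * (S\<^sup>2 / ?m / 2 * (1 - \<alpha>)\<^sup>2) + (1 - \<alpha>) * (S\<^sup>2 / ?m / 2 * (- \<alpha>)\<^sup>2) =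
        \<alpha> * (1 - \<alpha>) * S\<^sup>2 / 2 * (1 / ?m)"
      using quad[of "S\<^sup>2 / ?m"] by simp
    moreover have "\<alpha> * (1 - \<alpha>) * S\<^sup>2 / 2 * (1 / ?m) \<le> \<alpha> * (1 - \<alpha>) * S\<^sup>2 / 2 * (1 / \<beta>)"
      using \<alpha> by (intro mult_left_mono \<beta>(2)) auto
    moreover have "\<alpha> * (1 - \<alpha>) * S\<^sup>2 / (2 * \<beta>) = \<alpha> * (1 - \<alpha>) * S\<^sup>2 / 2 * (1 / \<beta>)"
      by simp
    moreover have "\<alpha> * ?E (w + (1 - \<alpha>) *\<^sub>R s) + (1 - \<alpha>) * ?E (w - \<alpha> *\<^sub>R s) =
        ?E 0 - \<mu> * ln (H 0) + \<alpha> * (\<mu> * ln (H (w + (1 - \<alpha>) *\<^sub>R s))) +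
        (1 - \<alpha>) * (\<mu> * ln (H (w - \<alpha> *\<^sub>R s)))"
      unfolding E_eq[of "w + _"] E_eq[of "w - _"] by (simp add: algebra_simps)
    moreover have "?E w = ?E 0 - \<mu> * ln (H 0) + \<mu> * ln (H w)"
      using E_eq[of w] by (simp add: algebra_simps)
    ultimately show "\<alpha> * ?E (w + (1 - \<alpha>) *\<^sub>R s) + (1 - \<alpha>) * ?E (w - \<alpha> *\<^sub>R s)
        - \<alpha> * (1 - \<alpha>) * S\<^sup>2 / (2 * \<beta>) \<le> ?E w"
      unfolding right_diff_distrib[of _ "\<mu> * ln _"] by linarith
  next
    fix p :: "real ^ 'n" assume p: "p \<in> prob_simplex"
    define C where "C = \<mu> * ln (H 0) - ?E 0 - (\<Sum>i\<in>UNIV. p $ i * ln (c i))"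
    \<comment> \<open>Averaging the bounds \<open>\<mu> * ln (H u) \<ge> u $ i + ln (c i)\<close> with the weights \<open>p $ i\<close> shows
      that \<open>p \<bullet> u - ?E u\<close> is bounded above in \<open>u\<close>.\<close>
    show "\<bar>convex_conjugate ?E p\<bar> \<noteq> \<infinity>"
    proof (rule convex_conjugate_finite)
      fix u
      have "ln (c i) + u $ i \<le> \<mu> * ln (H u)" for i
      proof -
        have "ln ((c i * exp (u $ i)) powr (1 / \<mu>)) \<le> ln (H u)"
          using H_ge[of i u] H_pos[of u] c[of i] by (subst ln_le_cancel_iff) auto
        then show ?thesis
          using c[of i] \<open>0 < \<mu>\<close> by (simp add: ln_powr ln_mult field_simps)
      qed
      then have "(\<Sum>i\<in>UNIV. p $ i * (ln (c i) + u $ i)) \<le> (\<Sum>i\<in>UNIV. p $ i * (\<mu> * ln (H u)))"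
        using p by (intro sum_mono mult_left_mono) (auto simp: prob_simplex_def)
      also have "\<dots> = \<mu> * ln (H u)"
        using p by (simp add: prob_simplex_def flip: sum_distrib_right)
      finally show "p \<bullet> u - ?E u \<le> C"
        unfolding E_eq[of u] C_def inner_vec_def by (simp add: algebra_simps sum.distrib)
    qed
  qed
qed

end
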